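(* Let $G$ be a group with identity element $e$ and suppose that $G$ has a finite subnormal series $$\langle e\rangle = G_0 \vartriangleleft G_1 \vartriangleleft \ldots \vartriangleleft G_k = G$$ with quotients $G_{i+1}/G_i$ all of which are torsion-free abelian. If $R$ is a $G$-crossed product with $R_e$ a domain, then every unit in $R$ is homogeneous with respect to the $G$-grading, and $R$ is a domain. In particular, every idempotent in $R$ is trivial.
   Context: Rings are associative, not necessarily commutative. A ring $R$ is $G$-graded if there is a collection $\{R_g\}_{g\in G}$ of additive subgroups of $R$ such that $R=\oplus_{g\in G}R_g$ and $R_gR_h\subseteq R_{gh}$ for all $g,h\in G$. A nonzero element of $R$ is homogeneous if it belongs to $R_g$ for some $g\in G$. A unital $G$-graded ring $R$ is a $G$-crossed product if, for each $g\in G$, the component $R_g$ contains an element which is invertible in $R$. A domain is a nonzero (not necessarily commutative) ring in which the product of any two nonzero elements is nonzero. An idempotent is trivial if it equals $0$ or $1_R$. *)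

theory Defs
  imports "HOL-Algebra.Algebra"
begin

text \<open>
  Associative rings, neither commutative nor unital. The unit is left out so that the component
  of degree \<open>\<one>\<close> of a graded ring is a ring by construction; a unital ring is the library's
  \<^locale>\<open>ring\<close>. The library's \<^locale>\<open>domain\<close> is commutative and hence not used.
\<close>

locale nonunital_ring = abelian_group R for R (structure) +
  assumes mult_closed: "\<lbrakk>x \<in> carrier R; y \<in> carrier R\<rbrakk> \<Longrightarrow> x \<otimes> y \<in> carrier R"
    and mult_assoc: "\<lbrakk>x \<in> carrier R; y \<in> carrier R; z \<in> carrier R\<rbrakk>
      \<Longrightarrow> (x \<otimes> y) \<otimes> z = x \<otimes> (y \<otimes> z)"
    and distrib_right: "\<lbrakk>x \<in> carrier R; y \<in> carrier R; z \<in> carrier R\<rbrakk>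
      \<Longrightarrow> (x \<oplus> y) \<otimes> z = x \<otimes> z \<oplus> y \<otimes> z"
    and distrib_left: "\<lbrakk>x \<in> carrier R; y \<in> carrier R; z \<in> carrier R\<rbrakk>
      \<Longrightarrow> z \<otimes> (x \<oplus> y) = z \<otimes> x \<oplus> z \<otimes> y"

locale noncomm_domain = nonunital_ring R for R (structure) +
  assumes nonzero: "carrier R \<noteq> {\<zero>}"
    and no_zero_divisors: "\<lbrakk>x \<in> carrier R; y \<in> carrier R; x \<noteq> \<zero>; y \<noteq> \<zero>\<rbrakk> \<Longrightarrow> x \<otimes> y \<noteq> \<zero>"

text \<open>
  \<open>R\<close> is the internal direct sum of the family \<open>S\<close>: every element is in exactly one way a
  finitely supported sum of elements of the \<open>S g\<close>. The summation is restricted to the support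
  because \<^const>\<open>finsum\<close> over an infinite index set is \<open>\<zero>\<close>; the extensional function space
  \<open>\<Pi>\<^sub>E\<close> makes \<open>f\<close> unique as a total function.
\<close>

definition is_direct_sum ::
  "('r, 'b) ring_scheme \<Rightarrow> 'g set \<Rightarrow> ('g \<Rightarrow> 'r set) \<Rightarrow> bool" where
  "is_direct_sum R I S \<longleftrightarrow>
     (\<forall>g\<in>I. additive_subgroup (S g) R) \<and>
     (\<forall>r\<in>carrier R. \<exists>!f. f \<in> (\<Pi>\<^sub>E g\<in>I. S g) \<and> finite {g\<in>I. f g \<noteq> \<zero>\<^bsub>R\<^esub>} \<and>
        r = (\<Oplus>\<^bsub>R\<^esub>g\<in>{g\<in>I. f g \<noteq> \<zero>\<^bsub>R\<^esub>}. f g))"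

locale unital_graded_ring = G?: group G + R?: ring R
  for G :: "('g, 'a) monoid_scheme" and R :: "('r, 'b) ring_scheme" +
  fixes S :: "'g \<Rightarrow> 'r set"
  assumes direct_sum: "is_direct_sum R (carrier G) S"
    and component_mult: "\<lbrakk>g \<in> carrier G; h \<in> carrier G; x \<in> S g; y \<in> S h\<rbrakk>
      \<Longrightarrow> x \<otimes>\<^bsub>R\<^esub> y \<in> S (g \<otimes>\<^bsub>G\<^esub> h)"

locale crossed_product = unital_graded_ring G R S
  for G :: "('g, 'a) monoid_scheme" and R :: "('r, 'b) ring_scheme" and S :: "'g \<Rightarrow> 'r set" +
  assumes component_unit: "g \<in> carrier G \<Longrightarrow> \<exists>u\<in>S g. u \<in> Units R"

definition homogeneous ::
  "('g, 'a) monoid_scheme \<Rightarrow> ('r, 'b) ring_scheme \<Rightarrow> ('g \<Rightarrow> 'r set) \<Rightarrow> 'r \<Rightarrow> bool" where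
  "homogeneous G R S x \<longleftrightarrow> x \<noteq> \<zero>\<^bsub>R\<^esub> \<and> (\<exists>g\<in>carrier G. x \<in> S g)"

definition torsion_free :: "('g, 'a) monoid_scheme \<Rightarrow> bool" where
  "torsion_free G \<longleftrightarrow>
     (\<forall>x\<in>carrier G. \<forall>n::nat. n > 0 \<and> x [^]\<^bsub>G\<^esub> n = \<one>\<^bsub>G\<^esub> \<longrightarrow> x = \<one>\<^bsub>G\<^esub>)"

definition subnormal_series ::
  "('g, 'a) monoid_scheme \<Rightarrow> (nat \<Rightarrow> 'g set) \<Rightarrow> nat \<Rightarrow> bool" where
  "subnormal_series G H k \<longleftrightarrow>
     (\<forall>i\<le>k. subgroup (H i) G) \<and> H 0 = {\<one>\<^bsub>G\<^esub>} \<and> H k = carrier G \<and>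
     (\<forall>i<k. H i \<lhd> G\<lparr>carrier := H (Suc i)\<rparr>)"

end

theory Submission
  imports Defs
begin

text \<open>
  A series with torsion-free abelian quotients makes \<open>G\<close> right-orderable: a torsion-free abelian
  group is orderable (\<open>torsion_free_ex_positive_cone\<close>, by Zorn's lemma), and an order on a
  normal subgroup and one on the quotient combine lexicographically
  (\<open>positive_cone_extension\<close>). Two-sided invariance would not survive the second step, since
  conjugation need not preserve the order on the normal subgroup; right invariance does, and it
  is enough for what follows.

  In a right-ordered group the greatest and the least element of a product set \<open>AB\<close> of finite
  nonempty sets are each attained by one pair only
  (\<open>positive_cone_two_unique_products\<close>). Let \<open>r\<close> and \<open>s\<close> be nonzero elements of the crossed
  product and let \<open>A\<close> and \<open>B\<close> be their supports. At the degree of a uniquely attained product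
  \<open>ab\<close> nothing can cancel, so the component of \<open>rs\<close> is the product of the components of \<open>r\<close> at
  \<open>a\<close> and of \<open>s\<close> at \<open>b\<close>. It is nonzero: homogeneous units shift the two factors into degree
  \<open>\<one>\<close>, where the ring has no zero divisors (\<open>homogeneous_mult_nonzero\<close>). Hence \<open>rs\<close> is nonzero
  and the ring is a domain.

  If moreover \<open>rs = 1\<close>, the support of \<open>rs\<close> is \<open>{\<one>}\<close>, so the greatest and the least element
  of \<open>AB\<close> coincide. Then \<open>AB\<close> is a point which is attained once, so \<open>A\<close> is a point and \<open>r\<close> is
  homogeneous. An idempotent \<open>x\<close> satisfies \<open>x(x - 1) = 0\<close> and is therefore trivial in a domain.
\<close>

section \<open>Positive cones and right orders\<close>

text \<open>
  A pointed submonoid \<open>P\<close> is the set of elements \<open>\<ge> \<one>\<close> of the partial order in which \<open>x \<ge> y\<close>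
  means \<open>x \<otimes> inv y \<in> P\<close>. This order is invariant under right multiplication, because
  \<open>(x \<otimes> z) \<otimes> inv (y \<otimes> z) = x \<otimes> inv y\<close>, but in general not under left multiplication; a
  positive cone is the case of a total order. The unit is included in \<open>P\<close>, so that \<open>P\<close> is a
  monoid and the order reflexive.
\<close>

definition pointed_submonoid :: "('g, 'a) monoid_scheme \<Rightarrow> 'g set \<Rightarrow> bool" where
  "pointed_submonoid G P \<longleftrightarrow>
     P \<subseteq> carrier G \<and> \<one>\<^bsub>G\<^esub> \<in> P \<and> (\<forall>x\<in>P. \<forall>y\<in>P. x \<otimes>\<^bsub>G\<^esub> y \<in> P) \<and>
     (\<forall>x\<in>P. inv\<^bsub>G\<^esub> x \<in> P \<longrightarrow> x = \<one>\<^bsub>G\<^esub>)"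

definition positive_cone :: "('g, 'a) monoid_scheme \<Rightarrow> 'g set \<Rightarrow> bool" where
  "positive_cone G P \<longleftrightarrow>
     pointed_submonoid G P \<and> (\<forall>x\<in>carrier G. x \<in> P \<or> inv\<^bsub>G\<^esub> x \<in> P)"

lemma pointed_submonoidD:
  assumes "pointed_submonoid G P"
  shows "\<And>x. x \<in> P \<Longrightarrow> x \<in> carrier G" and "\<one>\<^bsub>G\<^esub> \<in> P"
    and "\<And>x y. \<lbrakk>x \<in> P; y \<in> P\<rbrakk> \<Longrightarrow> x \<otimes>\<^bsub>G\<^esub> y \<in> P"
    and "\<And>x. \<lbrakk>x \<in> P; inv\<^bsub>G\<^esub> x \<in> P\<rbrakk> \<Longrightarrow> x = \<one>\<^bsub>G\<^esub>"
  using assms by (auto simp: pointed_submonoid_def)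

lemma pointed_submonoid_nat_pow:
  assumes "pointed_submonoid G P" and "monoid G" and "x \<in> P"
  shows "x [^]\<^bsub>G\<^esub> (n::nat) \<in> P"
  by (induction n)
    (use assms in \<open>auto simp: pointed_submonoidD monoid.nat_pow_0 monoid.nat_pow_Suc\<close>)

context group
begin

text \<open>
  The reversed order is right-invariant too; it turns statements about greatest elements into
  statements about least ones.
\<close>

lemma positive_cone_inverse:
  assumes "positive_cone G P"
  shows "positive_cone G {x \<in> carrier G. inv x \<in> P}"
  using assms unfolding positive_cone_def pointed_submonoid_def
  by (auto simp: inv_mult_group)

lemma positive_cone_antisym:
  assumes "positive_cone G P" and "x \<in> carrier G" and "y \<in> carrier G"
    and "x \<otimes> inv y \<in> P" and "y \<otimes> inv x \<in> P"
  shows "x = y"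
proof -
  have "inv (x \<otimes> inv y) = y \<otimes> inv x"
    using assms by (simp add: inv_mult_group)
  then have "x \<otimes> inv y = \<one>"
    using assms pointed_submonoidD(4)[of G P "x \<otimes> inv y"] by (simp add: positive_cone_def)
  then show ?thesis
    using assms inv_equality by fastforce
qed

lemma positive_cone_trans:
  assumes "positive_cone G P" and "x \<in> carrier G" and "y \<in> carrier G" and "z \<in> carrier G"
    and "x \<otimes> inv y \<in> P" and "y \<otimes> inv z \<in> P"
  shows "x \<otimes> inv z \<in> P"
proof -
  have "(x \<otimes> inv y) \<otimes> (y \<otimes> inv z) \<in> P"
    using assms pointed_submonoidD(3) by (fastforce simp: positive_cone_def)
  moreover have "(x \<otimes> inv y) \<otimes> (y \<otimes> inv z) = x \<otimes> inv z"
    using assms by (simp add: m_assoc inv_solve_left')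
  ultimately show ?thesis by simp
qed

lemma positive_cone_ex_greatest:
  assumes P: "positive_cone G P" and "finite A" and "A \<noteq> {}" and "A \<subseteq> carrier G"
  shows "\<exists>m\<in>A. \<forall>a\<in>A. m \<otimes> inv a \<in> P"
  using assms(2-4)
proof (induction A rule: finite_ne_induct)
  case (singleton x)
  then show ?case using P by (simp add: positive_cone_def pointed_submonoid_def)
next
  case (insert x A)
  then obtain m where m: "m \<in> A" "\<And>a. a \<in> A \<Longrightarrow> m \<otimes> inv a \<in> P" by auto
  have x: "x \<in> carrier G" and mG: "m \<in> carrier G" and AG: "A \<subseteq> carrier G"
    using insert.prems m by auto
  have "x \<otimes> inv x \<in> P"
    using P x by (simp add: positive_cone_def pointed_submonoid_def)
  moreover have "m \<otimes> inv x \<in> P \<or> x \<otimes> inv m \<in> P"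
  proof -
    have "inv (m \<otimes> inv x) = x \<otimes> inv m" using x mG by (simp add: inv_mult_group)
    then show ?thesis using P x mG by (metis positive_cone_def inv_closed m_closed)
  qed
  moreover have "x \<otimes> inv a \<in> P" if "x \<otimes> inv m \<in> P" "a \<in> A" for a
    using that m(2) positive_cone_trans[OF P x mG] AG by blast
  ultimately show ?case using m by blast
qed

text \<open>
  The lexicographic order: an element outside \<open>N\<close> has the sign of its coset, and an element of
  \<open>N\<close> the sign that it has there. A product with one factor in \<open>N\<close> stays in the coset of the
  other factor, so closure under multiplication never compares an element of \<open>N\<close> with its
  conjugates.
\<close>

lemma positive_cone_extension:
  assumes "N \<lhd> G" and P: "positive_cone (G\<lparr>carrier := N\<rparr>) P" and Q: "positive_cone (G Mod N) Q"
  shows "positive_cone G (P \<union> {x \<in> carrier G - N. N #> x \<in> Q})"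
proof -
  interpret N: normal N G by fact
  interpret M: group "G Mod N" by (rule N.factorgroup_is_group)
  have sub: "subgroup N G" by (rule N.subgroup_axioms)
  have invN: "inv\<^bsub>G\<lparr>carrier := N\<rparr>\<^esub> x = inv x" if "x \<in> N" for x
    using that sub by (simp add: m_inv_consistent)
  have PN: "P \<subseteq> N"
    using P by (simp add: positive_cone_def pointed_submonoid_def)
  then have invP: "inv\<^bsub>G\<lparr>carrier := N\<rparr>\<^esub> x = inv x" if "x \<in> P" for x
    using that invN by blast
  have P': "P \<subseteq> N" "\<one> \<in> P" "\<And>x y. \<lbrakk>x \<in> P; y \<in> P\<rbrakk> \<Longrightarrow> x \<otimes> y \<in> P"
    "\<And>x. \<lbrakk>x \<in> P; inv x \<in> P\<rbrakk> \<Longrightarrow> x = \<one>" "\<And>x. x \<in> N \<Longrightarrow> x \<in> P \<or> inv x \<in> P"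
    using P by (simp_all add: positive_cone_def pointed_submonoid_def invN invP)
  have cosC: "N #> x \<in> carrier (G Mod N)" if "x \<in> carrier G" for x
    using that by (auto simp: FactGroup_def RCOSETS_def)
  have one: "\<one>\<^bsub>G Mod N\<^esub> = N" by (simp add: FactGroup_def)
  have mult: "(N #> x) \<otimes>\<^bsub>G Mod N\<^esub> (N #> y) = N #> (x \<otimes> y)"
    if "x \<in> carrier G" "y \<in> carrier G" for x y
    using that by (simp add: FactGroup_def N.rcos_sum)
  have inv: "inv\<^bsub>G Mod N\<^esub> (N #> x) = N #> inv x" if "x \<in> carrier G" for x
    using that N.inv_FactGroup[OF cosC] N.rcos_inv by simp
  have inN: "x \<in> N \<longleftrightarrow> N #> x = N" if "x \<in> carrier G" for x
    using that sub coset_join1 coset_join2 by blast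
  have Q': "\<And>x y. \<lbrakk>x \<in> Q; y \<in> Q\<rbrakk> \<Longrightarrow> x \<otimes>\<^bsub>G Mod N\<^esub> y \<in> Q"
    "\<And>x. \<lbrakk>x \<in> Q; inv\<^bsub>G Mod N\<^esub> x \<in> Q\<rbrakk> \<Longrightarrow> x = N"
    "\<And>x. x \<in> carrier (G Mod N) \<Longrightarrow> x \<in> Q \<or> inv\<^bsub>G Mod N\<^esub> x \<in> Q" "Q \<subseteq> carrier (G Mod N)"
    using Q unfolding positive_cone_def pointed_submonoid_def one by auto
  let ?U = "{x \<in> carrier G - N. N #> x \<in> Q}"
  have NG: "\<And>x. x \<in> N \<Longrightarrow> x \<in> carrier G" using N.subset by auto
  have inv_mem: "inv x \<in> N \<longleftrightarrow> x \<in> N" if "x \<in> carrier G" for x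
    using that N.m_inv_closed[of x] N.m_inv_closed[of "inv x"] by auto
  have UU: "x \<otimes> y \<in> ?U" if "x \<in> ?U" "y \<in> ?U" for x y
  proof -
    have xy: "N #> (x \<otimes> y) \<in> Q" using that Q'(1) mult by fastforce
    \<comment> \<open>Otherwise the two cosets are inverse to each other and both positive, hence trivial.\<close>
    have "x \<otimes> y \<notin> N"
    proof
      assume "x \<otimes> y \<in> N"
      then have "N #> (x \<otimes> y) = N" using that inN by auto
      then have "(N #> x) \<otimes>\<^bsub>G Mod N\<^esub> (N #> y) = \<one>\<^bsub>G Mod N\<^esub>" using that mult one by auto
      then have "inv\<^bsub>G Mod N\<^esub> (N #> y) = N #> x"
        using that M.inv_equality cosC by auto
      then show False using that Q'(2)[of "N #> y"] inN by auto
    qed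
    then show ?thesis using xy that by auto
  qed
  have PU: "x \<otimes> y \<in> ?U" if "x \<in> N" "y \<in> ?U" for x y
  proof -
    have "N #> (x \<otimes> y) = N #> y"
      using that mult[of x y, symmetric] NG inN[of x] one M.l_one[OF cosC[of y]] by simp
    then show ?thesis using that NG inN[of "x \<otimes> y"] inN[of y] by auto
  qed
  have UP: "x \<otimes> y \<in> ?U" if "x \<in> ?U" "y \<in> N" for x y
  proof -
    have "N #> (x \<otimes> y) = N #> x"
      using that mult[of x y, symmetric] NG inN[of y] one M.r_one[OF cosC[of x]] by simp
    then show ?thesis using that NG inN[of "x \<otimes> y"] inN[of x] by auto
  qed
  have "x = \<one>" if x: "x \<in> P \<union> ?U" "inv x \<in> P \<union> ?U" for x
  proof (cases "x \<in> N")
    case True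
    then show ?thesis using x P'(4) by auto
  next
    case False
    then have "x \<in> ?U" using x P' by auto
    moreover from this have "inv x \<in> ?U" using x P'(1) inv_mem[of x] by blast
    ultimately show ?thesis using Q'(2)[of "N #> x"] inv[of x] inN[of x] by simp
  qed
  moreover have "x \<in> P \<union> ?U \<or> inv x \<in> P \<union> ?U" if x: "x \<in> carrier G" for x
  proof (cases "x \<in> N")
    case True
    then show ?thesis using P' by auto
  next
    case False
    moreover have "N #> x \<in> Q \<or> N #> inv x \<in> Q"
      using Q'(3)[OF cosC[OF x]] unfolding inv[OF x] .
    ultimately show ?thesis using x inv_mem[OF x] by auto
  qed
  moreover have "x \<otimes> y \<in> P \<union> ?U" if "x \<in> P \<union> ?U" "y \<in> P \<union> ?U" for x y
    using that UU[of x y] PU[of x y] UP[of x y] P'(1) P'(3)[of x y] by blast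
  moreover have "P \<union> ?U \<subseteq> carrier G" "\<one> \<in> P \<union> ?U" using P'(1,2) NG by auto
  ultimately show ?thesis unfolding positive_cone_def pointed_submonoid_def by blast
qed

end

text \<open>
  Commutativity makes the products \<open>m \<otimes> x [^] n\<close> a submonoid. If two of them are inverse to each
  other then \<open>inv (x [^] (n + n'))\<close> lies in \<open>M\<close>, so the hypothesis forces \<open>n = n' = 0\<close> and the
  pointedness of \<open>M\<close> applies.
\<close>

lemma (in comm_group) pointed_submonoid_adjoin:
  assumes M: "pointed_submonoid G M" and x: "x \<in> carrier G"
    and neg: "\<And>n::nat. n > 0 \<Longrightarrow> inv (x [^] n) \<notin> M"
  shows "pointed_submonoid G {m \<otimes> x [^] (n::nat) | m n. m \<in> M}"
proof -
  let ?M' = "{m \<otimes> x [^] (n::nat) | m n. m \<in> M}"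
  note MG = pointed_submonoidD(1)[OF M]
  have "\<one> \<in> ?M'"
    using pointed_submonoidD(2)[OF M] by (auto intro!: exI[of _ \<one>] exI[of _ "0::nat"])
  have subset: "?M' \<subseteq> carrier G" using x MG by auto
  have mult: "(m \<otimes> x [^] n) \<otimes> (m' \<otimes> x [^] n') = (m \<otimes> m') \<otimes> x [^] (n + n')"
    if "m \<in> M" "m' \<in> M" for m m' and n n' :: nat
    using that x MG by (simp add: nat_pow_mult[symmetric] m_ac)
  have "y \<otimes> z \<in> ?M'" if yz: "y \<in> ?M'" "z \<in> ?M'" for y z
  proof -
    obtain m n m' n' where "m \<in> M" "m' \<in> M" "y = m \<otimes> x [^] (n::nat)" "z = m' \<otimes> x [^] (n'::nat)"
      using yz by auto
    then have "y \<otimes> z = (m \<otimes> m') \<otimes> x [^] (n + n')" "m \<otimes> m' \<in> M"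
      using mult pointed_submonoidD(3)[OF M] by auto
    then show ?thesis by blast
  qed
  moreover have "y = \<one>" if "y \<in> ?M'" "inv y \<in> ?M'" for y
  proof -
    obtain m n m' n' where m: "m \<in> M" "m' \<in> M"
      and y: "y = m \<otimes> x [^] (n::nat)" and z: "inv y = m' \<otimes> x [^] (n'::nat)"
      using \<open>y \<in> ?M'\<close> \<open>inv y \<in> ?M'\<close> by auto
    have "y \<in> carrier G" using y m x MG by simp
    then have eq: "\<one> = (m \<otimes> m') \<otimes> x [^] (n + n')"
      using mult[OF m] y z by (metis r_inv)
    have mm: "m \<otimes> m' \<in> M" using m pointed_submonoidD(3)[OF M] by auto
    then have "inv (x [^] (n + n')) = m \<otimes> m'"
      using eq inv_equality x MG by simp
    then have n: "n = 0" "n' = 0" using neg[of "n + n'"] mm by (metis add_gr_0 gr0I)+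
    then have "m \<otimes> m' = \<one>" using eq m MG by simp
    then have "inv m = m'" using m MG by (metis inv_equality m_comm)
    then show ?thesis using pointed_submonoidD(4)[OF M] m n y MG by simp
  qed
  ultimately show ?thesis
    unfolding pointed_submonoid_def using \<open>\<one> \<in> ?M'\<close> subset by blast
qed

text \<open>
  A maximal pointed submonoid \<open>M\<close> is total. If neither \<open>x\<close> nor \<open>inv x\<close> can be adjoined to \<open>M\<close>,
  then \<open>M\<close> contains \<open>inv (x [^] m)\<close> and \<open>x [^] n\<close> for some positive \<open>m\<close> and \<open>n\<close>, hence both
  \<open>x [^] (n * m)\<close> and its inverse. So \<open>x\<close> is a torsion element and equals \<open>\<one>\<close>.
\<close>

theorem (in comm_group) torsion_free_ex_positive_cone:
  assumes tf: "torsion_free G"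
  shows "\<exists>P. positive_cone G P"
proof -
  let ?\<A> = "Collect (pointed_submonoid G)"
  have "\<Union>\<C> \<in> ?\<A>" if \<C>: "\<C> \<noteq> {}" "subset.chain ?\<A> \<C>" for \<C>
  proof -
    have mem: "pointed_submonoid G M" if "M \<in> \<C>" for M
      using that \<C> by (auto simp: subset.chain_def)
    have common: "\<exists>M\<in>\<C>. x \<in> M \<and> y \<in> M" if xy: "x \<in> \<Union>\<C>" "y \<in> \<Union>\<C>" for x y
    proof -
      obtain M M' where "M \<in> \<C>" "M' \<in> \<C>" "x \<in> M" "y \<in> M'" using xy by auto
      then show ?thesis using \<C>(2) by (meson subset_chain_def subsetD)
    qed
    have "x \<otimes> y \<in> \<Union>\<C>" if xy: "x \<in> \<Union>\<C>" "y \<in> \<Union>\<C>" for x y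
      using common[OF xy] pointed_submonoidD(3)[OF mem] by blast
    moreover have "x = \<one>" if xy: "x \<in> \<Union>\<C>" "inv x \<in> \<Union>\<C>" for x
      using common[OF xy] pointed_submonoidD(4)[OF mem] by blast
    moreover have "\<Union>\<C> \<subseteq> carrier G" "\<one> \<in> \<Union>\<C>"
      using \<C>(1) pointed_submonoidD(1,2)[OF mem] by blast+
    ultimately have "pointed_submonoid G (\<Union>\<C>)" unfolding pointed_submonoid_def by blast
    then show ?thesis by simp
  qed
  moreover have "{\<one>} \<in> ?\<A>" by (simp add: pointed_submonoid_def)
  ultimately obtain M where M: "pointed_submonoid G M"
    and max: "\<And>M'. \<lbrakk>pointed_submonoid G M'; M \<subseteq> M'\<rbrakk> \<Longrightarrow> M' = M"
    using subset_Zorn_nonempty[of ?\<A>] by auto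
  have adjoin: "x \<in> M" if x: "x \<in> carrier G" and neg: "\<And>n::nat. n > 0 \<Longrightarrow> inv (x [^] n) \<notin> M" for x
  proof -
    let ?M' = "{m \<otimes> x [^] (n::nat) | m n. m \<in> M}"
    have "m \<in> ?M'" if "m \<in> M" for m
      using that pointed_submonoidD(1)[OF M] by (auto intro!: exI[of _ m] exI[of _ "0::nat"])
    then have "?M' = M"
      using max[OF pointed_submonoid_adjoin[OF M x neg]] by blast
    moreover have "x \<in> ?M'"
      using x pointed_submonoidD(2)[OF M] by (auto intro!: exI[of _ \<one>] exI[of _ "1::nat"])
    ultimately show ?thesis by simp
  qed
  have "x \<in> M \<or> inv x \<in> M" if x: "x \<in> carrier G" for x
  proof (rule ccontr)
    assume "\<not> (x \<in> M \<or> inv x \<in> M)"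
    then obtain m n :: nat where mn: "m > 0" "n > 0" "inv (x [^] m) \<in> M" "inv (inv x [^] n) \<in> M"
      using adjoin[OF x] adjoin[of "inv x"] x by auto
    then have xn: "x [^] n \<in> M" using x by (simp add: nat_pow_inv)
    have "(x [^] n) [^] m \<in> M" "inv (x [^] m) [^] n \<in> M"
      using pointed_submonoid_nat_pow[OF M] mn xn by auto
    moreover have "inv (x [^] m) [^] n = inv ((x [^] n) [^] m)"
      using x by (simp add: nat_pow_inv nat_pow_pow mult.commute)
    ultimately have "(x [^] n) [^] m = \<one>" using pointed_submonoidD(4)[OF M] by auto
    then have "x [^] (n * m) = \<one>" using x by (simp add: nat_pow_pow)
    then have "x = \<one>" using tf x mn by (simp add: torsion_free_def) (metis mult_pos_pos)
    then show False using \<open>\<not> (x \<in> M \<or> inv x \<in> M)\<close> pointed_submonoidD(2)[OF M] by simp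
  qed
  then show ?thesis using M by (auto simp: positive_cone_def)
qed

lemma (in group) subnormal_series_ex_positive_cone:
  assumes H: "subnormal_series G H k"
    and ab: "\<And>i. i < k \<Longrightarrow> comm_group (G\<lparr>carrier := H (Suc i)\<rparr> Mod H i)"
    and tf: "\<And>i. i < k \<Longrightarrow> torsion_free (G\<lparr>carrier := H (Suc i)\<rparr> Mod H i)"
  shows "\<exists>P. positive_cone G P"
proof -
  have "i \<le> k \<Longrightarrow> \<exists>P. positive_cone (G\<lparr>carrier := H i\<rparr>) P" for i
  proof (induction i)
    case 0
    have "positive_cone (G\<lparr>carrier := {\<one>}\<rparr>) {\<one>}"
      using m_inv_consistent[OF triv_subgroup, of \<one>]
      by (simp add: positive_cone_def pointed_submonoid_def)
    then show ?case using H by (auto simp: subnormal_series_def)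
  next
    case (Suc i)
    then obtain P where P: "positive_cone (G\<lparr>carrier := H i\<rparr>) P" by auto
    obtain Q where Q: "positive_cone (G\<lparr>carrier := H (Suc i)\<rparr> Mod H i) Q"
      using comm_group.torsion_free_ex_positive_cone[OF ab tf, of i] Suc.prems by auto
    have "subgroup (H (Suc i)) G" and N: "H i \<lhd> G\<lparr>carrier := H (Suc i)\<rparr>"
      using H Suc.prems by (auto simp: subnormal_series_def)
    then interpret K: group "G\<lparr>carrier := H (Suc i)\<rparr>"
      by (simp add: subgroup_imp_group)
    show ?case using K.positive_cone_extension[OF N _ Q] P by auto
  qed
  from this[of k] show ?thesis using H by (simp add: subnormal_series_def)
qed

section \<open>Unique products\<close>

definition unique_product :: "('g, 'a) monoid_scheme \<Rightarrow> 'g set \<Rightarrow> 'g set \<Rightarrow> 'g \<Rightarrow> 'g \<Rightarrow> bool" where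
  "unique_product G A B a b \<longleftrightarrow> a \<in> A \<and> b \<in> B \<and>
     (\<forall>a'\<in>A. \<forall>b'\<in>B. a' \<otimes>\<^bsub>G\<^esub> b' = a \<otimes>\<^bsub>G\<^esub> b \<longrightarrow> a' = a \<and> b' = b)"

text \<open>
  With \<open>a\<close> the greatest element of \<open>A\<close>, right invariance gives \<open>a' \<otimes> b' \<le> a \<otimes> b'\<close> for each \<open>b'\<close>.
  The greatest product is therefore the greatest element of \<open>a \<otimes> B\<close>, which by cancellation comes
  from one \<open>b\<close> only. This \<open>b\<close> need not be the greatest element of \<open>B\<close>, because left
  multiplication by \<open>a\<close> may disturb the order.
\<close>

lemma (in group) positive_cone_greatest_product:
  assumes P: "positive_cone G P"
    and A: "finite A" "A \<noteq> {}" "A \<subseteq> carrier G" and B: "finite B" "B \<noteq> {}" "B \<subseteq> carrier G"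
  shows "\<exists>a b. unique_product G A B a b \<and> (\<forall>a'\<in>A. \<forall>b'\<in>B. (a \<otimes> b) \<otimes> inv (a' \<otimes> b') \<in> P)"
proof -
  obtain a where a: "a \<in> A" and amax: "\<And>a'. a' \<in> A \<Longrightarrow> a \<otimes> inv a' \<in> P"
    using positive_cone_ex_greatest[OF P A] by auto
  have aG: "a \<in> carrier G" using a A by auto
  have "finite ((\<otimes>) a ` B)" "(\<otimes>) a ` B \<noteq> {}" "(\<otimes>) a ` B \<subseteq> carrier G"
    using B aG by auto
  from positive_cone_ex_greatest[OF P this]
  obtain b where b: "b \<in> B" and bmax: "\<And>b'. b' \<in> B \<Longrightarrow> (a \<otimes> b) \<otimes> inv (a \<otimes> b') \<in> P"
    by auto
  have le: "(a \<otimes> b') \<otimes> inv (a' \<otimes> b') \<in> P" if "a' \<in> A" "b' \<in> B" for a' b'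
  proof -
    have "a' \<in> carrier G" "b' \<in> carrier G" using that A B by auto
    moreover from this have "b' \<otimes> (inv b' \<otimes> inv a') = inv a'"
      by (simp add: m_assoc[symmetric])
    ultimately have "(a \<otimes> b') \<otimes> inv (a' \<otimes> b') = a \<otimes> inv a'"
      using aG by (simp add: inv_mult_group m_assoc)
    then show ?thesis using amax that by simp
  qed
  have "a' = a \<and> b' = b" if ab: "a' \<in> A" "b' \<in> B" and eq: "a' \<otimes> b' = a \<otimes> b" for a' b'
  proof -
    have G: "a' \<in> carrier G" "b' \<in> carrier G" "b \<in> carrier G" using ab b A B by auto
    have "a \<otimes> b' = a \<otimes> b"
      using positive_cone_antisym[OF P, of "a \<otimes> b'" "a \<otimes> b"] le[OF ab] bmax[OF ab(2)] eq G aG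
      by simp
    then show ?thesis using eq G aG by simp
  qed
  moreover have "(a \<otimes> b) \<otimes> inv (a' \<otimes> b') \<in> P" if "a' \<in> A" "b' \<in> B" for a' b'
    using positive_cone_trans[OF P _ _ _ bmax[OF that(2)] le[OF that]] that a b A B by auto
  ultimately have "unique_product G A B a b \<and> (\<forall>a'\<in>A. \<forall>b'\<in>B. (a \<otimes> b) \<otimes> inv (a' \<otimes> b') \<in> P)"
    using a b unfolding unique_product_def by blast
  then show ?thesis by blast
qed

text \<open>
  The two pairs attain the greatest and the least product. If these agree then all products
  agree, and since the product is attained only once there is only one pair.
\<close>

lemma (in group) positive_cone_two_unique_products:
  assumes P: "positive_cone G P"
    and A: "finite A" "A \<noteq> {}" "A \<subseteq> carrier G" and B: "finite B" "B \<noteq> {}" "B \<subseteq> carrier G"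
  obtains a b c d where "unique_product G A B a b" and "unique_product G A B c d"
    and "a \<otimes> b = c \<otimes> d \<Longrightarrow> A = {a} \<and> B = {b}"
proof -
  obtain a b where ab: "unique_product G A B a b"
    and greatest: "\<And>a' b'. \<lbrakk>a' \<in> A; b' \<in> B\<rbrakk> \<Longrightarrow> (a \<otimes> b) \<otimes> inv (a' \<otimes> b') \<in> P"
    using positive_cone_greatest_product[OF P A B] by auto
  obtain c d where cd: "unique_product G A B c d"
    and "\<And>a' b'. \<lbrakk>a' \<in> A; b' \<in> B\<rbrakk> \<Longrightarrow> inv ((c \<otimes> d) \<otimes> inv (a' \<otimes> b')) \<in> P"
    using positive_cone_greatest_product[OF positive_cone_inverse[OF P] A B] by auto
  moreover have "c \<in> carrier G" "d \<in> carrier G" using cd A B by (auto simp: unique_product_def)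
  ultimately have least: "(a' \<otimes> b') \<otimes> inv (c \<otimes> d) \<in> P" if "a' \<in> A" "b' \<in> B" for a' b'
    using that A B by (simp add: inv_mult_group subset_iff m_assoc)
  have "A = {a} \<and> B = {b}" if eq: "a \<otimes> b = c \<otimes> d"
  proof -
    have "a' = a \<and> b' = b" if "a' \<in> A" "b' \<in> B" for a' b'
    proof -
      have mem: "a \<in> A" "b \<in> B" using ab by (auto simp: unique_product_def)
      have "a' \<otimes> b' = a \<otimes> b"
      proof (rule positive_cone_antisym[OF P])
        show "a' \<otimes> b' \<in> carrier G" "a \<otimes> b \<in> carrier G" using that mem A B by auto
        show "(a' \<otimes> b') \<otimes> inv (a \<otimes> b) \<in> P" using least[OF that] eq by simp
      qed (rule greatest[OF that])
      then show ?thesis using that ab unfolding unique_product_def by blast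
    qed
    then show ?thesis using A(2) B(2) by blast
  qed
  then show ?thesis using that ab cd by blast
qed

section \<open>Homogeneous components\<close>

context unital_graded_ring
begin

definition homogeneous_part :: "'r \<Rightarrow> 'g \<Rightarrow> 'r" where
  "homogeneous_part r = (THE f. f \<in> (\<Pi>\<^sub>E g\<in>carrier G. S g) \<and>
     finite {g \<in> carrier G. f g \<noteq> \<zero>\<^bsub>R\<^esub>} \<and>
     r = (\<Oplus>\<^bsub>R\<^esub>g\<in>{g \<in> carrier G. f g \<noteq> \<zero>\<^bsub>R\<^esub>}. f g))"

definition grade_support :: "'r \<Rightarrow> 'g set" where
  "grade_support r = {g \<in> carrier G. homogeneous_part r g \<noteq> \<zero>\<^bsub>R\<^esub>}"

lemma component_subgroup: "g \<in> carrier G \<Longrightarrow> additive_subgroup (S g) R"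
  using direct_sum by (simp add: is_direct_sum_def)

lemma component_carrier: "g \<in> carrier G \<Longrightarrow> x \<in> S g \<Longrightarrow> x \<in> carrier R"
  using component_subgroup additive_subgroup.a_Hcarr by fast

lemma zero_in_component: "g \<in> carrier G \<Longrightarrow> \<zero>\<^bsub>R\<^esub> \<in> S g"
  using component_subgroup additive_subgroup.zero_closed by fast

lemma homogeneous_part_decomposition:
  assumes "r \<in> carrier R"
  shows "homogeneous_part r \<in> (\<Pi>\<^sub>E g\<in>carrier G. S g) \<and> finite (grade_support r) \<and>
    r = (\<Oplus>\<^bsub>R\<^esub>g\<in>grade_support r. homogeneous_part r g)"
proof -
  have "\<exists>!f. f \<in> (\<Pi>\<^sub>E g\<in>carrier G. S g) \<and> finite {g \<in> carrier G. f g \<noteq> \<zero>\<^bsub>R\<^esub>} \<and>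
     r = (\<Oplus>\<^bsub>R\<^esub>g\<in>{g \<in> carrier G. f g \<noteq> \<zero>\<^bsub>R\<^esub>}. f g)"
    using direct_sum assms by (simp add: is_direct_sum_def)
  from theI'[OF this] show ?thesis
    unfolding homogeneous_part_def[symmetric] grade_support_def .
qed

lemma homogeneous_part_in: "r \<in> carrier R \<Longrightarrow> g \<in> carrier G \<Longrightarrow> homogeneous_part r g \<in> S g"
  using homogeneous_part_decomposition by auto

lemma homogeneous_part_closed:
  "r \<in> carrier R \<Longrightarrow> g \<in> carrier G \<Longrightarrow> homogeneous_part r g \<in> carrier R"
  using homogeneous_part_in component_carrier by blast

lemma finite_grade_support: "r \<in> carrier R \<Longrightarrow> finite (grade_support r)"
  using homogeneous_part_decomposition by auto

lemma grade_support_subset: "grade_support r \<subseteq> carrier G"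
  by (auto simp: grade_support_def)

text \<open>
  The computation rule for components: any finite homogeneous decomposition determines them,
  also one over an index set \<open>A\<close> which is larger than the support or contains zero summands.
\<close>

lemma homogeneous_part_eqI:
  assumes A: "finite A" "A \<subseteq> carrier G" and f: "\<And>g. g \<in> carrier G \<Longrightarrow> f g \<in> S g"
    and zero: "\<And>g. g \<in> carrier G - A \<Longrightarrow> f g = \<zero>\<^bsub>R\<^esub>"
    and r: "r = (\<Oplus>\<^bsub>R\<^esub>g\<in>A. f g)" and g: "g \<in> carrier G"
  shows "homogeneous_part r g = f g"
proof -
  let ?f = "restrict f (carrier G)"
  have fC: "f g \<in> carrier R" if "g \<in> carrier G" for g using f that component_carrier by blast
  have sub: "{g \<in> carrier G. ?f g \<noteq> \<zero>\<^bsub>R\<^esub>} \<subseteq> A" using zero by auto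
  have rC: "r \<in> carrier R" unfolding r using A fC by (intro R.finsum_closed) auto
  have "r = (\<Oplus>\<^bsub>R\<^esub>g\<in>{g \<in> carrier G. ?f g \<noteq> \<zero>\<^bsub>R\<^esub>}. ?f g)"
    unfolding r using A fC sub
    by (intro R.add.finprod_mono_neutral_cong_left[symmetric]) auto
  then have f_dec: "?f \<in> (\<Pi>\<^sub>E g\<in>carrier G. S g) \<and> finite {g \<in> carrier G. ?f g \<noteq> \<zero>\<^bsub>R\<^esub>} \<and>
     r = (\<Oplus>\<^bsub>R\<^esub>g\<in>{g \<in> carrier G. ?f g \<noteq> \<zero>\<^bsub>R\<^esub>}. ?f g)"
    using f finite_subset[OF sub A(1)] by auto
  have "\<exists>!f. f \<in> (\<Pi>\<^sub>E g\<in>carrier G. S g) \<and> finite {g \<in> carrier G. f g \<noteq> \<zero>\<^bsub>R\<^esub>} \<and>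
     r = (\<Oplus>\<^bsub>R\<^esub>g\<in>{g \<in> carrier G. f g \<noteq> \<zero>\<^bsub>R\<^esub>}. f g)"
    using direct_sum rC by (simp add: is_direct_sum_def)
  from the1_equality[OF this, OF f_dec] have "homogeneous_part r = ?f"
    unfolding homogeneous_part_def .
  then show ?thesis using g by simp
qed

lemma homogeneous_part_component:
  assumes x: "x \<in> S h" and h: "h \<in> carrier G" and g: "g \<in> carrier G"
  shows "homogeneous_part x g = (if g = h then x else \<zero>\<^bsub>R\<^esub>)"
proof (rule homogeneous_part_eqI[of "{h}"])
  show "x = (\<Oplus>\<^bsub>R\<^esub>g\<in>{h}. if g = h then x else \<zero>\<^bsub>R\<^esub>)"
    using component_carrier[OF h x] by simp
qed (use assms zero_in_component in auto)

lemma homogeneous_part_add: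
  assumes r: "r \<in> carrier R" and s: "s \<in> carrier R" and g: "g \<in> carrier G"
  shows "homogeneous_part (r \<oplus>\<^bsub>R\<^esub> s) g = homogeneous_part r g \<oplus>\<^bsub>R\<^esub> homogeneous_part s g"
proof (rule homogeneous_part_eqI[of "grade_support r \<union> grade_support s"])
  let ?A = "grade_support r \<union> grade_support s"
  show fin: "finite ?A" using r s finite_grade_support by simp
  show sub: "?A \<subseteq> carrier G" using grade_support_subset by simp
  have extend: "t = (\<Oplus>\<^bsub>R\<^esub>g\<in>?A. homogeneous_part t g)"
    if t: "t \<in> carrier R" "grade_support t \<subseteq> ?A" for t
  proof -
    have "(\<Oplus>\<^bsub>R\<^esub>g\<in>grade_support t. homogeneous_part t g) = (\<Oplus>\<^bsub>R\<^esub>g\<in>?A. homogeneous_part t g)"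
      using t fin sub homogeneous_part_closed
      by (intro R.add.finprod_mono_neutral_cong_left) (auto simp: grade_support_def)
    then show ?thesis using t homogeneous_part_decomposition by simp
  qed
  have "(\<Oplus>\<^bsub>R\<^esub>g\<in>?A. homogeneous_part r g \<oplus>\<^bsub>R\<^esub> homogeneous_part s g) =
    (\<Oplus>\<^bsub>R\<^esub>g\<in>?A. homogeneous_part r g) \<oplus>\<^bsub>R\<^esub> (\<Oplus>\<^bsub>R\<^esub>g\<in>?A. homogeneous_part s g)"
    using r s sub homogeneous_part_closed by (intro R.finsum_addf) auto
  then show "r \<oplus>\<^bsub>R\<^esub> s = (\<Oplus>\<^bsub>R\<^esub>g\<in>?A. homogeneous_part r g \<oplus>\<^bsub>R\<^esub> homogeneous_part s g)"
    using extend[OF r] extend[OF s] by simp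
  show "homogeneous_part r g \<oplus>\<^bsub>R\<^esub> homogeneous_part s g \<in> S g" if "g \<in> carrier G" for g
    using that r s homogeneous_part_in additive_subgroup.a_closed[OF component_subgroup] by blast
  show "homogeneous_part r g \<oplus>\<^bsub>R\<^esub> homogeneous_part s g = \<zero>\<^bsub>R\<^esub>" if "g \<in> carrier G - ?A" for g
    using that by (auto simp: grade_support_def)
qed (rule g)

lemma homogeneous_part_zero: "g \<in> carrier G \<Longrightarrow> homogeneous_part \<zero>\<^bsub>R\<^esub> g = \<zero>\<^bsub>R\<^esub>"
  using homogeneous_part_component[of "\<zero>\<^bsub>R\<^esub>" g g] zero_in_component by simp

lemma homogeneous_part_finsum:
  assumes "finite A" and "\<And>a. a \<in> A \<Longrightarrow> f a \<in> carrier R" and "g \<in> carrier G"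
  shows "homogeneous_part (\<Oplus>\<^bsub>R\<^esub>a\<in>A. f a) g = (\<Oplus>\<^bsub>R\<^esub>a\<in>A. homogeneous_part (f a) g)"
  using assms
proof (induction A rule: finite_induct)
  case empty
  then show ?case by (simp add: homogeneous_part_zero)
next
  case (insert a A)
  then have "f \<in> A \<rightarrow> carrier R" "f a \<in> carrier R"
    "(\<lambda>a. homogeneous_part (f a) g) \<in> A \<rightarrow> carrier R" "homogeneous_part (f a) g \<in> carrier R"
    using homogeneous_part_closed by auto
  then show ?case using insert by (simp add: homogeneous_part_add)
qed

lemma grade_support_empty_iff:
  assumes "r \<in> carrier R"
  shows "grade_support r = {} \<longleftrightarrow> r = \<zero>\<^bsub>R\<^esub>"
proof
  assume "grade_support r = {}"
  then show "r = \<zero>\<^bsub>R\<^esub>" using homogeneous_part_decomposition[OF assms] by simp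
qed (auto simp: grade_support_def homogeneous_part_zero)

text \<open>
  Left multiplication by an element of degree \<open>g\<close> shifts degrees by \<open>g\<close>. With this rule the
  components of a product \<open>r \<otimes> s\<close> need a single sum over the support of \<open>r\<close> and no regrouping
  of a double sum by degree.
\<close>

lemma homogeneous_part_mult_component:
  assumes x: "x \<in> S g" and g: "g \<in> carrier G" and r: "r \<in> carrier R" and h: "h \<in> carrier G"
  shows "homogeneous_part (x \<otimes>\<^bsub>R\<^esub> r) h = x \<otimes>\<^bsub>R\<^esub> homogeneous_part r (inv\<^bsub>G\<^esub> g \<otimes>\<^bsub>G\<^esub> h)"
proof -
  let ?B = "grade_support r" and ?k = "inv\<^bsub>G\<^esub> g \<otimes>\<^bsub>G\<^esub> h"
  have xC: "x \<in> carrier R" using component_carrier g x by blast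
  have k: "?k \<in> carrier G" using g h by simp
  have B: "finite ?B" "?B \<subseteq> carrier G" using r finite_grade_support grade_support_subset by auto
  have rC: "homogeneous_part r b \<in> carrier R" if "b \<in> ?B" for b
    using that B r homogeneous_part_closed by blast
  have iff: "h = g \<otimes>\<^bsub>G\<^esub> b \<longleftrightarrow> b = ?k" if "b \<in> ?B" for b
    using that B g h by (metis G.inv_solve_left subsetD)
  have part: "homogeneous_part (x \<otimes>\<^bsub>R\<^esub> homogeneous_part r b) h =
      (if b = ?k then x \<otimes>\<^bsub>R\<^esub> homogeneous_part r b else \<zero>\<^bsub>R\<^esub>)" if b: "b \<in> ?B" for b
    using homogeneous_part_component[OF component_mult[OF g _ x homogeneous_part_in[OF r]], of b h]
      b B g h iff[OF b] by auto
  have "x \<otimes>\<^bsub>R\<^esub> r = x \<otimes>\<^bsub>R\<^esub> (\<Oplus>\<^bsub>R\<^esub>b\<in>?B. homogeneous_part r b)"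
    using homogeneous_part_decomposition[OF r] by simp
  also have "\<dots> = (\<Oplus>\<^bsub>R\<^esub>b\<in>?B. x \<otimes>\<^bsub>R\<^esub> homogeneous_part r b)"
    using B rC xC by (intro R.finsum_rdistr) auto
  finally have "homogeneous_part (x \<otimes>\<^bsub>R\<^esub> r) h =
      (\<Oplus>\<^bsub>R\<^esub>b\<in>?B. homogeneous_part (x \<otimes>\<^bsub>R\<^esub> homogeneous_part r b) h)"
    using homogeneous_part_finsum[OF B(1) _ h] rC xC by simp
  also have "\<dots> = (\<Oplus>\<^bsub>R\<^esub>b\<in>?B. if b = ?k then x \<otimes>\<^bsub>R\<^esub> homogeneous_part r b else \<zero>\<^bsub>R\<^esub>)"
    using part rC xC by (intro R.finsum_cong') auto
  also have "\<dots> = x \<otimes>\<^bsub>R\<^esub> homogeneous_part r ?k"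
  proof (cases "?k \<in> ?B")
    case True
    have "(\<Oplus>\<^bsub>R\<^esub>b\<in>?B. if ?k = b then x \<otimes>\<^bsub>R\<^esub> homogeneous_part r b else \<zero>\<^bsub>R\<^esub>) =
        x \<otimes>\<^bsub>R\<^esub> homogeneous_part r ?k"
      using B True rC xC by (intro R.finsum_singleton) auto
    then show ?thesis by (simp add: eq_commute)
  next
    case False
    then have "homogeneous_part r ?k = \<zero>\<^bsub>R\<^esub>" using k by (simp add: grade_support_def)
    moreover have "(\<Oplus>\<^bsub>R\<^esub>b\<in>?B. if b = ?k then x \<otimes>\<^bsub>R\<^esub> homogeneous_part r b else \<zero>\<^bsub>R\<^esub>) = \<zero>\<^bsub>R\<^esub>"
      using False by (intro R.add.finprod_one_eqI) auto
    ultimately show ?thesis using xC by simp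
  qed
  finally show ?thesis .
qed

text \<open>
  Let \<open>e\<close> be the component of \<open>1\<close> in degree \<open>\<one>\<close>. For \<open>x\<close> of degree \<open>g\<close>, comparing components of
  degree \<open>g\<close> in \<open>x \<otimes> 1 = x\<close> gives \<open>x \<otimes> e = x\<close>. By additivity \<open>e\<close> is a right unit of the whole
  ring, so \<open>e = 1\<close>.
\<close>

lemma one_in_component: "\<one>\<^bsub>R\<^esub> \<in> S \<one>\<^bsub>G\<^esub>"
proof -
  let ?e = "homogeneous_part \<one>\<^bsub>R\<^esub> \<one>\<^bsub>G\<^esub>" and ?A = "grade_support \<one>\<^bsub>R\<^esub>"
  have eC: "?e \<in> carrier R" using homogeneous_part_closed by simp
  have neutral: "x \<otimes>\<^bsub>R\<^esub> ?e = x" if x: "x \<in> S g" and g: "g \<in> carrier G" for x g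
    using homogeneous_part_mult_component[OF x g R.one_closed g]
      homogeneous_part_component[OF x g g] component_carrier[OF g x] g by simp
  have A: "finite ?A" "?A \<subseteq> carrier G" using finite_grade_support grade_support_subset by auto
  have one: "\<one>\<^bsub>R\<^esub> = (\<Oplus>\<^bsub>R\<^esub>g\<in>?A. homogeneous_part \<one>\<^bsub>R\<^esub> g)"
    using homogeneous_part_decomposition[of "\<one>\<^bsub>R\<^esub>"] by simp
  have "?e = (\<Oplus>\<^bsub>R\<^esub>g\<in>?A. homogeneous_part \<one>\<^bsub>R\<^esub> g) \<otimes>\<^bsub>R\<^esub> ?e" using one eC by simp
  also have "\<dots> = (\<Oplus>\<^bsub>R\<^esub>g\<in>?A. homogeneous_part \<one>\<^bsub>R\<^esub> g \<otimes>\<^bsub>R\<^esub> ?e)"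
    using A eC homogeneous_part_closed by (intro R.finsum_ldistr) auto
  also have "\<dots> = (\<Oplus>\<^bsub>R\<^esub>g\<in>?A. homogeneous_part \<one>\<^bsub>R\<^esub> g)"
    using A homogeneous_part_in homogeneous_part_closed
    by (intro R.finsum_cong') (auto intro!: neutral)
  also have "\<dots> = \<one>\<^bsub>R\<^esub>" using one by simp
  finally show ?thesis using homogeneous_part_in[of "\<one>\<^bsub>R\<^esub>" "\<one>\<^bsub>G\<^esub>"] by simp
qed

text \<open>
  The component of \<open>r \<otimes> s\<close> in degree \<open>a \<otimes> b\<close> is the sum, over the support of \<open>r\<close>, of the part
  of \<open>r\<close> in degree \<open>g\<close> times the part of \<open>s\<close> in degree \<open>inv g \<otimes> (a \<otimes> b)\<close>. The latter degree lies
  in the support of \<open>s\<close> only for \<open>g = a\<close>.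
\<close>

lemma homogeneous_part_unique_product:
  assumes r: "r \<in> carrier R" and s: "s \<in> carrier R"
    and ab: "unique_product G (grade_support r) (grade_support s) a b"
  shows "homogeneous_part (r \<otimes>\<^bsub>R\<^esub> s) (a \<otimes>\<^bsub>G\<^esub> b) = homogeneous_part r a \<otimes>\<^bsub>R\<^esub> homogeneous_part s b"
proof -
  let ?A = "grade_support r" and ?h = "a \<otimes>\<^bsub>G\<^esub> b"
  have A: "finite ?A" "?A \<subseteq> carrier G" using r finite_grade_support grade_support_subset by auto
  have a: "a \<in> ?A" and b: "b \<in> grade_support s" using ab by (auto simp: unique_product_def)
  have G: "a \<in> carrier G" "b \<in> carrier G" using a b grade_support_subset by blast+
  have rC: "homogeneous_part r g \<in> carrier R" if "g \<in> ?A" for g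
    using that A r homogeneous_part_closed by blast
  have bC: "homogeneous_part s b \<in> carrier R" using G s homogeneous_part_closed by blast
  have summand: "homogeneous_part (homogeneous_part r g \<otimes>\<^bsub>R\<^esub> s) ?h =
      (if a = g then homogeneous_part r g \<otimes>\<^bsub>R\<^esub> homogeneous_part s b else \<zero>\<^bsub>R\<^esub>)"
    if g: "g \<in> ?A" for g
  proof -
    let ?k = "inv\<^bsub>G\<^esub> g \<otimes>\<^bsub>G\<^esub> ?h"
    have gG: "g \<in> carrier G" and k: "?k \<in> carrier G" using g A G by auto
    have prod: "g \<otimes>\<^bsub>G\<^esub> ?k = ?h" using gG G by (simp add: G.m_assoc[symmetric])
    have eq: "homogeneous_part (homogeneous_part r g \<otimes>\<^bsub>R\<^esub> s) ?h =
        homogeneous_part r g \<otimes>\<^bsub>R\<^esub> homogeneous_part s ?k"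
      using homogeneous_part_mult_component[OF homogeneous_part_in[OF r gG] gG s] G by simp
    show ?thesis
    proof (cases "?k \<in> grade_support s")
      case True
      then have "g = a" "?k = b" using ab g prod by (auto simp: unique_product_def)
      then show ?thesis using eq by simp
    next
      case False
      then have "g \<noteq> a" using b G by (auto simp: G.m_assoc[symmetric])
      moreover have "homogeneous_part s ?k = \<zero>\<^bsub>R\<^esub>"
        using False k by (simp add: grade_support_def)
      ultimately show ?thesis using eq rC[OF g] by simp
    qed
  qed
  have "r \<otimes>\<^bsub>R\<^esub> s = (\<Oplus>\<^bsub>R\<^esub>g\<in>?A. homogeneous_part r g) \<otimes>\<^bsub>R\<^esub> s"
    using homogeneous_part_decomposition[OF r] by simp
  also have "\<dots> = (\<Oplus>\<^bsub>R\<^esub>g\<in>?A. homogeneous_part r g \<otimes>\<^bsub>R\<^esub> s)"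
    using A s rC by (intro R.finsum_ldistr) auto
  finally have "homogeneous_part (r \<otimes>\<^bsub>R\<^esub> s) ?h =
      (\<Oplus>\<^bsub>R\<^esub>g\<in>?A. homogeneous_part (homogeneous_part r g \<otimes>\<^bsub>R\<^esub> s) ?h)"
    using homogeneous_part_finsum[OF A(1)] rC s G by simp
  also have "\<dots> = (\<Oplus>\<^bsub>R\<^esub>g\<in>?A. if a = g then homogeneous_part r g \<otimes>\<^bsub>R\<^esub> homogeneous_part s b else \<zero>\<^bsub>R\<^esub>)"
    using summand rC bC by (intro R.finsum_cong') auto
  also have "\<dots> = homogeneous_part r a \<otimes>\<^bsub>R\<^esub> homogeneous_part s b"
    using A a rC bC by (intro R.finsum_singleton) auto
  finally show ?thesis .
qed

lemma singleton_grade_support_homogeneous: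
  assumes r: "r \<in> carrier R" and "grade_support r = {g}"
  shows "homogeneous G R S r"
proof -
  have g: "g \<in> carrier G" using assms grade_support_subset[of r] by auto
  then have "r = homogeneous_part r g"
    using homogeneous_part_decomposition[OF r] assms homogeneous_part_closed[OF r] by simp
  then have "r \<in> S g" using homogeneous_part_in[OF r g] by simp
  moreover have "r \<noteq> \<zero>\<^bsub>R\<^esub>" using grade_support_empty_iff[OF r] assms by auto
  ultimately show ?thesis using g by (auto simp: homogeneous_def)
qed

end

section \<open>Crossed products over right-ordered groups\<close>

context crossed_product
begin

text \<open>
  Units \<open>u\<close> and \<open>v\<close> of degrees \<open>inv g\<close> and \<open>inv h\<close> move \<open>u \<otimes> x\<close> and \<open>y \<otimes> v\<close> into degree \<open>\<one>\<close>, where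
  their product is nonzero; it equals \<open>u \<otimes> (x \<otimes> y) \<otimes> v\<close>. Multiplying on the outer sides keeps \<open>x\<close>
  and \<open>y\<close> adjacent, so no conjugation by units enters.
\<close>

lemma homogeneous_mult_nonzero:
  assumes dom: "noncomm_domain (R\<lparr>carrier := S \<one>\<^bsub>G\<^esub>\<rparr>)"
    and g: "g \<in> carrier G" and h: "h \<in> carrier G" and x: "x \<in> S g" and y: "y \<in> S h"
    and nonzero: "x \<noteq> \<zero>\<^bsub>R\<^esub>" "y \<noteq> \<zero>\<^bsub>R\<^esub>"
  shows "x \<otimes>\<^bsub>R\<^esub> y \<noteq> \<zero>\<^bsub>R\<^esub>"
proof
  assume xy: "x \<otimes>\<^bsub>R\<^esub> y = \<zero>\<^bsub>R\<^esub>"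
  obtain u where u: "u \<in> S (inv\<^bsub>G\<^esub> g)" "u \<in> Units R" using component_unit g by blast
  obtain v where v: "v \<in> S (inv\<^bsub>G\<^esub> h)" "v \<in> Units R" using component_unit h by blast
  have C: "x \<in> carrier R" "y \<in> carrier R" "u \<in> carrier R" "v \<in> carrier R"
    using component_carrier g h x y u v by auto
  have ux: "u \<otimes>\<^bsub>R\<^esub> x \<in> S \<one>\<^bsub>G\<^esub>" using component_mult[OF _ g u(1) x] g by simp
  have yv: "y \<otimes>\<^bsub>R\<^esub> v \<in> S \<one>\<^bsub>G\<^esub>" using component_mult[OF h _ y v(1)] h by simp
  have "u \<otimes>\<^bsub>R\<^esub> x \<noteq> \<zero>\<^bsub>R\<^esub>"
    using R.Units_l_cancel[OF u(2) C(1) R.zero_closed] C nonzero by simp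
  moreover have "y \<otimes>\<^bsub>R\<^esub> v \<noteq> \<zero>\<^bsub>R\<^esub>"
  proof
    assume "y \<otimes>\<^bsub>R\<^esub> v = \<zero>\<^bsub>R\<^esub>"
    then have "(y \<otimes>\<^bsub>R\<^esub> v) \<otimes>\<^bsub>R\<^esub> inv\<^bsub>R\<^esub> v = \<zero>\<^bsub>R\<^esub>" using v by simp
    then show False using C v nonzero by (simp add: R.m_assoc)
  qed
  ultimately have "(u \<otimes>\<^bsub>R\<^esub> x) \<otimes>\<^bsub>R\<^esub> (y \<otimes>\<^bsub>R\<^esub> v) \<noteq> \<zero>\<^bsub>R\<^esub>"
    using noncomm_domain.no_zero_divisors[OF dom] ux yv by simp
  moreover have "(u \<otimes>\<^bsub>R\<^esub> x) \<otimes>\<^bsub>R\<^esub> (y \<otimes>\<^bsub>R\<^esub> v) = u \<otimes>\<^bsub>R\<^esub> ((x \<otimes>\<^bsub>R\<^esub> y) \<otimes>\<^bsub>R\<^esub> v)"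
    using C by (simp add: R.m_assoc)
  ultimately show False using xy C by simp
qed

lemma unique_product_in_grade_support:
  assumes dom: "noncomm_domain (R\<lparr>carrier := S \<one>\<^bsub>G\<^esub>\<rparr>)"
    and r: "r \<in> carrier R" and s: "s \<in> carrier R"
    and ab: "unique_product G (grade_support r) (grade_support s) a b"
  shows "a \<otimes>\<^bsub>G\<^esub> b \<in> grade_support (r \<otimes>\<^bsub>R\<^esub> s)"
proof -
  have "a \<in> grade_support r" "b \<in> grade_support s" using ab by (auto simp: unique_product_def)
  then show ?thesis
    using homogeneous_part_unique_product[OF r s ab]
      homogeneous_mult_nonzero[OF dom _ _ homogeneous_part_in[OF r] homogeneous_part_in[OF s]]
    by (simp add: grade_support_def)
qed

lemma right_ordered_mult_nonzero:
  assumes P: "positive_cone G P" and dom: "noncomm_domain (R\<lparr>carrier := S \<one>\<^bsub>G\<^esub>\<rparr>)"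
    and r: "r \<in> carrier R" "r \<noteq> \<zero>\<^bsub>R\<^esub>" and s: "s \<in> carrier R" "s \<noteq> \<zero>\<^bsub>R\<^esub>"
  shows "r \<otimes>\<^bsub>R\<^esub> s \<noteq> \<zero>\<^bsub>R\<^esub>"
proof -
  obtain a b where "unique_product G (grade_support r) (grade_support s) a b"
    using G.positive_cone_greatest_product[OF P, of "grade_support r" "grade_support s"]
      r s grade_support_empty_iff finite_grade_support grade_support_subset by metis
  then have "grade_support (r \<otimes>\<^bsub>R\<^esub> s) \<noteq> {}"
    using unique_product_in_grade_support[OF dom r(1) s(1)] by auto
  then show ?thesis using grade_support_empty_iff[OF R.zero_closed] by auto
qed

lemma right_ordered_noncomm_domain:
  assumes P: "positive_cone G P" and dom: "noncomm_domain (R\<lparr>carrier := S \<one>\<^bsub>G\<^esub>\<rparr>)"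
  shows "noncomm_domain R"
proof
  have "S \<one>\<^bsub>G\<^esub> \<noteq> {\<zero>\<^bsub>R\<^esub>}" using noncomm_domain.nonzero[OF dom] by simp
  then show "carrier R \<noteq> {\<zero>\<^bsub>R\<^esub>}"
    using zero_in_component[of "\<one>\<^bsub>G\<^esub>"] component_carrier[of "\<one>\<^bsub>G\<^esub>"] by auto
qed (use right_ordered_mult_nonzero[OF P dom] in \<open>auto simp: R.m_assoc R.l_distr R.r_distr\<close>)

text \<open>
  In \<open>u \<otimes> inv u = 1\<close> both unique products must be the only degree \<open>\<one>\<close> of the right-hand side.
  They coincide, so the support of \<open>u\<close> is a single degree.
\<close>

lemma right_ordered_unit_homogeneous:
  assumes P: "positive_cone G P" and dom: "noncomm_domain (R\<lparr>carrier := S \<one>\<^bsub>G\<^esub>\<rparr>)"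
    and u: "u \<in> Units R"
  shows "homogeneous G R S u"
proof -
  let ?v = "inv\<^bsub>R\<^esub> u"
  interpret D: noncomm_domain R by (rule right_ordered_noncomm_domain[OF P dom])
  have C: "u \<in> carrier R" "?v \<in> carrier R" and uv: "u \<otimes>\<^bsub>R\<^esub> ?v = \<one>\<^bsub>R\<^esub>" using u by auto
  have "\<one>\<^bsub>R\<^esub> \<noteq> \<zero>\<^bsub>R\<^esub>" using D.nonzero R.carrier_one_zero by blast
  then have nz: "u \<noteq> \<zero>\<^bsub>R\<^esub>" "?v \<noteq> \<zero>\<^bsub>R\<^esub>" using uv C by auto
  have ne: "grade_support u \<noteq> {}" "grade_support ?v \<noteq> {}"
    using nz C grade_support_empty_iff by auto
  obtain a b c d where
    ab: "unique_product G (grade_support u) (grade_support ?v) a b" and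
    cd: "unique_product G (grade_support u) (grade_support ?v) c d" and
    eq: "a \<otimes>\<^bsub>G\<^esub> b = c \<otimes>\<^bsub>G\<^esub> d \<Longrightarrow> grade_support u = {a} \<and> grade_support ?v = {b}"
    using G.positive_cone_two_unique_products[OF P
        finite_grade_support[OF C(1)] ne(1) grade_support_subset
        finite_grade_support[OF C(2)] ne(2) grade_support_subset] by blast
  have "grade_support \<one>\<^bsub>R\<^esub> \<subseteq> {\<one>\<^bsub>G\<^esub>}"
    using homogeneous_part_component[OF one_in_component]
    by (auto simp: grade_support_def split: if_splits)
  then have "a \<otimes>\<^bsub>G\<^esub> b = \<one>\<^bsub>G\<^esub>" "c \<otimes>\<^bsub>G\<^esub> d = \<one>\<^bsub>G\<^esub>"
    using unique_product_in_grade_support[OF dom C ab]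
      unique_product_in_grade_support[OF dom C cd] uv by auto
  then show ?thesis using eq singleton_grade_support_homogeneous[OF C(1)] by auto
qed

end

lemma (in ring) noncomm_domain_idempotent_trivial:
  assumes "noncomm_domain R" and x: "x \<in> carrier R" and "x \<otimes> x = x"
  shows "x = \<zero> \<or> x = \<one>"
proof -
  have "x \<otimes> (x \<ominus> \<one>) = \<zero>"
    using assms by (simp add: minus_eq r_distr r_minus r_neg)
  then have "x = \<zero> \<or> x \<ominus> \<one> = \<zero>"
    using noncomm_domain.no_zero_divisors[OF assms(1) x, of "x \<ominus> \<one>"] x by auto
  then show ?thesis using x by simp
qed

theorem theorem7p7:
  fixes G :: "('g, 'a) monoid_scheme" and R :: "('r, 'b) ring_scheme"
    and S :: "'g \<Rightarrow> 'r set" and H :: "nat \<Rightarrow> 'g set" and k :: nat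
  assumes "group G"
    and "subnormal_series G H k"
    and "\<And>i. i < k \<Longrightarrow> comm_group (G\<lparr>carrier := H (Suc i)\<rparr> Mod H i)"
    and "\<And>i. i < k \<Longrightarrow> torsion_free (G\<lparr>carrier := H (Suc i)\<rparr> Mod H i)"
    and "crossed_product G R S"
    and "noncomm_domain (R\<lparr>carrier := S \<one>\<^bsub>G\<^esub>\<rparr>)"
  shows "(\<forall>u\<in>Units R. homogeneous G R S u) \<and>
    noncomm_domain R \<and>
    (\<forall>x\<in>carrier R. x \<otimes>\<^bsub>R\<^esub> x = x \<longrightarrow> x = \<zero>\<^bsub>R\<^esub> \<or> x = \<one>\<^bsub>R\<^esub>)"
proof -
  interpret crossed_product G R S by fact
  obtain P where P: "positive_cone G P"
    using group.subnormal_series_ex_positive_cone assms(1-4) by blast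
  show ?thesis
    using right_ordered_unit_homogeneous[OF P assms(6)]
      right_ordered_noncomm_domain[OF P assms(6)] R.noncomm_domain_idempotent_trivial by blast
qed

end
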